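(* Let $h_{\bm a,b}$ be a linear classifier on $\mathbb{R}^p$ and let $f(\bm x)=\|\bm x\|_{N_1}$ be an arbitrary differentiable norm on $\mathbb{R}^p$. Let $\bm x_F\in\mathbb{R}^p$ be an arbitrary factual instance and let $q_{CF}(\bm x_F)=\bm x_{CF}^*$, with $\bm x_{CF}^*\ne\bm x_F$, be its corresponding optimal counterfactual under $\|\cdot\|_{N_1}$. Then this one counterfactual query is enough to extract the classifier's hyperplane: for $$\hat{\bm a}=\nabla f(\bm x_{CF}^*-\bm x_F),\qquad \hat b=\hat{\bm a}^\top\bm x_{CF}^*,$$ the hyperplane given by $(\hat{\bm a},\hat b)$ is equivalent to the original hyperplane with parameters $(\bm a,b)$.
   Context: A linear classifier with parameters $\bm a\in\mathbb{R}^p\setminus\{\bm 0\}$, $b\in\mathbb{R}$ is $h_{\bm a,b}:\mathbb{R}^p\to\{-1,1\}$ with $h_{\bm a,b}(\bm x)=1$ if $\bm a^\top\bm x-b\ge 0$ and $-1$ otherwise. Hyperplanes with parameters $(\bm a,b)$ and $(\hat{\bm a},\hat b)$ are equivalent if for all $\bm x\in\mathbb{R}^p$: $\hat{\bm a}^\top\bm x-\hat b=0$ if and only if $\bm a^\top\bm x-b=0$ (equivalently, $(\bm a,b)=\lambda(\hat{\bm a},\hat b)$ for some $\lambda\ne 0$). A norm is called differentiable if it is differentiable at every $\bm x\in\mathbb{R}^p\setminus\{\bm 0\}$. A counterfactual query $q_{CF}$ maps $\bm x$ to an optimal counterfactual: a point $\bm x_{CF}$ minimizing $\|\bm x_{CF}-\bm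 x\|_{N_1}$ subject to $\bm x_{CF}$ having the opposite class to $\bm x$. By convention the closure of the class regions is used: if $h_{\bm a,b}(\bm x)=-1$ one minimizes over $\{\bm z:\bm a^\top\bm z\ge b\}$, and if $h_{\bm a,b}(\bm x)=1$ over $\{\bm z:\bm a^\top\bm z\le b\}$. *)

theory Defs
  imports "HOL-Analysis.Analysis"
begin

definition is_norm :: "('v::real_vector \<Rightarrow> real) \<Rightarrow> bool" where
  "is_norm N \<longleftrightarrow>
     (\<forall>x. N x \<ge> 0) \<and>
     (\<forall>x. N x = 0 \<longleftrightarrow> x = 0) \<and>
     (\<forall>c x. N (c *\<^sub>R x) = \<bar>c\<bar> * N x) \<and>
     (\<forall>x y. N (x + y) \<le> N x + N y)"

definition differentiable_norm :: "('v::real_normed_vector \<Rightarrow> real) \<Rightarrow> bool" where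
  "differentiable_norm N \<longleftrightarrow> is_norm N \<and> (\<forall>x. x \<noteq> 0 \<longrightarrow> N differentiable (at x))"

text \<open>Only meaningful at points where \<open>f\<close> is differentiable; the value is unspecified elsewhere.\<close>

definition gradient :: "('v::real_inner \<Rightarrow> real) \<Rightarrow> 'v \<Rightarrow> 'v" where
  "gradient f x = (THE D. GDERIV f x :> D)"

lemma gradient_eqI:
  assumes "GDERIV f x :> D"
  shows "gradient f x = D"
  unfolding gradient_def
proof (rule the_equality)
  show "GDERIV f x :> D"
    by (rule assms)
next
  fix E
  assume "GDERIV f x :> E"
  then have "(\<lambda>h. inner h E) = (\<lambda>h. inner h D)"
    using assms has_derivative_unique unfolding gderiv_def by blast
  then have "inner h E = inner h D" for h
    by meson
  then have "inner (E - D) (E - D) = 0"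
    by (simp add: inner_diff_right)
  then show "E = D"
    by simp
qed

definition linear_classifier :: "real ^ 'p \<Rightarrow> real \<Rightarrow> real ^ 'p \<Rightarrow> int" where
  "linear_classifier a b x = (if a \<bullet> x - b \<ge> 0 then 1 else - 1)"

definition equivalent_hyperplanes ::
    "real ^ 'p \<Rightarrow> real \<Rightarrow> real ^ 'p \<Rightarrow> real \<Rightarrow> bool" where
  "equivalent_hyperplanes a' b' a b \<longleftrightarrow> (\<forall>x. a' \<bullet> x - b' = 0 \<longleftrightarrow> a \<bullet> x - b = 0)"

text \<open>The closure of the region whose class is opposite to that of \<open>x\<close>. The region of class
  \<open>- 1\<close> is open, so without the closure a point of class \<open>1\<close> would have no optimal counterfactual.\<close>

definition opposite_region :: "real ^ 'p \<Rightarrow> real \<Rightarrow> real ^ 'p \<Rightarrow> (real ^ 'p) set" where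
  "opposite_region a b x =
     (if linear_classifier a b x = - 1 then {z. a \<bullet> z \<ge> b} else {z. a \<bullet> z \<le> b})"

definition optimal_counterfactual ::
    "(real ^ 'p \<Rightarrow> real) \<Rightarrow> real ^ 'p \<Rightarrow> real \<Rightarrow> real ^ 'p \<Rightarrow> real ^ 'p \<Rightarrow> bool" where
  "optimal_counterfactual N a b x z \<longleftrightarrow>
     is_arg_min (\<lambda>y. N (y - x)) (\<lambda>y. y \<in> opposite_region a b x) z"

text \<open>Minimizers need not be unique for a norm that is not strictly convex, so a query is any
  function selecting one.\<close>

definition counterfactual_query ::
    "(real ^ 'p \<Rightarrow> real) \<Rightarrow> real ^ 'p \<Rightarrow> real \<Rightarrow> (real ^ 'p \<Rightarrow> real ^ 'p) \<Rightarrow> bool" where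
  "counterfactual_query N a b q \<longleftrightarrow> (\<forall>x. optimal_counterfactual N a b x (q x))"

end

theory Submission
  imports Defs
begin

text \<open>An optimal counterfactual lies on the hyperplane, since otherwise moving it slightly towards
  the factual instance would stay feasible and shrink the norm. It therefore minimizes the distance
  to the factual instance among all points of the hyperplane, so the gradient of the norm at the
  displacement is orthogonal to every direction of the hyperplane, i.e. it is a multiple of the
  normal vector. The multiple is nonzero by Euler's identity for homogeneous functions.\<close>

text \<open>The derivative is a linear functional on a Euclidean space, so it is the inner product
  with a fixed vector, namely \<open>adjoint f' 1\<close>.\<close>

lemma GDERIV_gradient:
  fixes f :: "'v::euclidean_space \<Rightarrow> real"
  assumes "f differentiable (at x)"
  shows "GDERIV f x :> gradient f x"
proof -
  obtain f' where f': "(f has_derivative f') (at x)"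
    using assms unfolding differentiable_def by blast
  then have "f' = (\<lambda>h. h \<bullet> adjoint f' 1)"
    by (simp add: adjoint_works has_derivative_linear)
  then have "GDERIV f x :> adjoint f' 1"
    using f' unfolding gderiv_def by metis
  then show ?thesis
    by (simp add: gradient_eqI)
qed

lemma GDERIV_directional:
  assumes "GDERIV f x :> D"
  shows "((\<lambda>t. f (x + t *\<^sub>R v)) has_real_derivative D \<bullet> v) (at 0)"
proof -
  have f: "(f has_derivative (\<lambda>h. h \<bullet> D)) (at (x + 0 *\<^sub>R v))"
    using assms by (simp add: gderiv_def)
  have line: "((\<lambda>t::real. x + t *\<^sub>R v) has_derivative (\<lambda>t. t *\<^sub>R v)) (at 0)"
    by (auto intro!: derivative_eq_intros)
  show ?thesis
    using has_derivative_compose[OF line f]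
    by (simp add: has_field_derivative_def inner_commute mult_commute_abs)
qed

text \<open>Euler's identity in degree one: along its own ray, \<open>f\<close> is the linear
  function \<open>(1 + t) * f x\<close> near \<open>t = 0\<close>.\<close>

lemma GDERIV_inner_self_norm:
  assumes "is_norm f" and "GDERIV f x :> D"
  shows "D \<bullet> x = f x"
proof -
  have "((\<lambda>t. f (x + t *\<^sub>R x)) has_real_derivative D \<bullet> x) (at 0)"
    by (rule GDERIV_directional) fact
  moreover have "((\<lambda>t. f (x + t *\<^sub>R x)) has_real_derivative f x) (at 0)"
  proof (rule has_field_derivative_transform_within_open)
    show "((\<lambda>t. (1 + t) * f x) has_real_derivative f x) (at 0)"
      by (auto intro!: derivative_eq_intros)
    fix t :: real
    \<comment> \<open>On this interval \<open>1 + t\<close> is positive, so the absolute value from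
      homogeneity disappears.\<close>
    assume "t \<in> {- 1<..<1}"
    moreover have "f ((1 + t) *\<^sub>R x) = \<bar>1 + t\<bar> * f x"
      using assms(1) by (simp add: is_norm_def)
    ultimately show "(1 + t) * f x = f (x + t *\<^sub>R x)"
      by (simp add: scaleR_left_distrib)
  qed auto
  ultimately show ?thesis
    by (rule DERIV_unique)
qed

lemma GDERIV_orthogonal_at_min:
  assumes "GDERIV f x :> D" and "\<And>t. f x \<le> f (x + t *\<^sub>R v)"
  shows "D \<bullet> v = 0"
  using DERIV_local_min[OF GDERIV_directional[OF assms(1)], of 1 v] assms(2) by simp

lemma multiple_if_orthogonal_complement:
  fixes a D :: "'v::real_inner"
  assumes "\<And>v. a \<bullet> v = 0 \<Longrightarrow> D \<bullet> v = 0"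
  obtains c where "D = c *\<^sub>R a"
proof (cases "a = 0")
  case True
  then have "D = 0 *\<^sub>R a"
    using assms[of D] by simp
  then show ?thesis
    by (rule that)
next
  case False
  \<comment> \<open>\<open>c *\<^sub>R a\<close> is the orthogonal projection of \<open>D\<close>
    onto the line of \<open>a\<close>, and \<open>v\<close> is the remainder, to be shown
    zero.\<close>
  define c where "c = a \<bullet> D / (a \<bullet> a)"
  define v where "v = D - c *\<^sub>R a"
  have "a \<bullet> v = 0"
    using False by (simp add: v_def c_def inner_diff_right)
  moreover from this have "D \<bullet> v = 0"
    by (rule assms)
  ultimately have "v \<bullet> v = 0"
    by (simp add: v_def inner_diff_left)
  then show ?thesis
    by (intro that[of c]) (simp add: v_def)
qed

lemma hyperplane_in_opposite_region:
  "a \<bullet> z = b \<Longrightarrow> z \<in> opposite_region a b x"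
  by (simp add: opposite_region_def)

lemma optimal_counterfactual_on_hyperplane:
  assumes "is_norm f" and opt: "optimal_counterfactual f a b x z" and "z \<noteq> x"
  shows "a \<bullet> z = b"
proof (rule ccontr)
  assume off: "a \<bullet> z \<noteq> b"
  have z: "z \<in> opposite_region a b x"
    using opt by (simp add: optimal_counterfactual_def is_arg_min_def)
  have min: "f (z - x) \<le> f (y - x)" if "y \<in> opposite_region a b x" for y
    using opt that by (auto simp: optimal_counterfactual_def is_arg_min_def not_less)
  have pos: "0 < f (z - x)"
    using assms by (metis is_norm_def order_le_less right_minus_eq)
  \<comment> \<open>The parameter at which the segment from \<open>x\<close> to \<open>z\<close>
    meets the hyperplane.\<close>
  define t where "t = (b - a \<bullet> x) / (a \<bullet> z - a \<bullet> x)"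
  \<comment> \<open>Points on the hyperplane have class 1, so \<open>x\<close> may lie on it, giving
    \<open>t = 0\<close>; as \<open>z\<close> lies strictly beyond, \<open>t < 1\<close> always
    holds.\<close>
  have sides: "a \<bullet> x < b \<and> b < a \<bullet> z \<or> a \<bullet> z < b \<and> b \<le> a \<bullet> x"
    using z off by (auto simp: opposite_region_def linear_classifier_def split: if_splits)
  then have t: "0 \<le> t" "t < 1"
    by (auto simp: t_def divide_simps)
  have "a \<bullet> (x + t *\<^sub>R (z - x)) = b"
    using sides by (auto simp: t_def inner_add_right inner_diff_right)
  then have "f (z - x) \<le> f (t *\<^sub>R (z - x))"
    using min[of "x + t *\<^sub>R (z - x)"] by (simp add: hyperplane_in_opposite_region)
  also have "\<dots> = t * f (z - x)"
    using assms(1) t by (simp add: is_norm_def)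
  finally show False
    using t pos by simp
qed

theorem theorem8:
  fixes a :: "real ^ 'p" and b :: real
    and f :: "real ^ 'p \<Rightarrow> real"
    and q :: "real ^ 'p \<Rightarrow> real ^ 'p"
    and x_F x_CF a_hat :: "real ^ 'p" and b_hat :: real
  assumes "a \<noteq> 0"
    and "differentiable_norm f"
    and "counterfactual_query f a b q"
    and "q x_F = x_CF"
    and "x_CF \<noteq> x_F"
    and "a_hat = gradient f (x_CF - x_F)"
    and "b_hat = a_hat \<bullet> x_CF"
  shows "equivalent_hyperplanes a_hat b_hat a b"
proof -
  have f: "is_norm f"
    using assms(2) by (simp add: differentiable_norm_def)
  have opt: "optimal_counterfactual f a b x_F x_CF"
    using assms(3,4) by (auto simp: counterfactual_query_def)
  have on: "a \<bullet> x_CF = b"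
    using f opt assms(5) by (rule optimal_counterfactual_on_hyperplane)
  have deriv: "GDERIV f (x_CF - x_F) :> a_hat"
    using assms(2,5,6) by (simp add: differentiable_norm_def GDERIV_gradient)
  \<comment> \<open>Moving from \<open>x_CF\<close> along \<open>v\<close> in either sense stays on
    the hyperplane, hence feasible, so \<open>t = 0\<close> is a two-sided minimum.\<close>
  have "a_hat \<bullet> v = 0" if "a \<bullet> v = 0" for v
    using deriv
  proof (rule GDERIV_orthogonal_at_min)
    fix t
    have "x_CF + t *\<^sub>R v \<in> opposite_region a b x_F"
      using on that by (simp add: hyperplane_in_opposite_region inner_add_right)
    then have "f (x_CF - x_F) \<le> f (x_CF + t *\<^sub>R v - x_F)"
      using opt by (auto simp: optimal_counterfactual_def is_arg_min_def not_less)
    then show "f (x_CF - x_F) \<le> f (x_CF - x_F + t *\<^sub>R v)"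
      by (simp add: algebra_simps)
  qed
  then obtain c where c: "a_hat = c *\<^sub>R a"
    by (rule multiple_if_orthogonal_complement)
  \<comment> \<open>By Euler's identity this inner product is the positive distance
    \<open>f (x_CF - x_F)\<close>; with \<open>c = 0\<close> it would vanish.\<close>
  have "a_hat \<bullet> (x_CF - x_F) \<noteq> 0"
    using GDERIV_inner_self_norm[OF f deriv] f assms(5) by (simp add: is_norm_def)
  then have "c \<noteq> 0"
    using c by auto
  then show ?thesis
    \<comment> \<open>Since \<open>x_CF\<close> is on the hyperplane, \<open>b_hat = c * b\<close>:
      both parameters scale by the same nonzero factor.\<close>
    using on assms(7) by (simp add: equivalent_hyperplanes_def c right_diff_distrib[symmetric])
qed

end
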